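(* Let $\alpha>-\frac12$ and let $f\in L^1_\alpha(\mathbb{R})$. Then the Bessel-Struve transform $\mathcal{F}_{B,S}^\alpha(f)$ belongs to $C_0(\mathbb{R})$. Furthermore, $$\|\mathcal{F}_{B,S}^\alpha(f)\|_\infty\le \|f\|_{1,\alpha}.$$
   Context: For $\alpha>-\frac12$, $\lambda\in\mathbb{C}$ and $x\in\mathbb{R}$, the Bessel-Struve kernel is $S_\lambda^\alpha(x)=j_\alpha(i\lambda x)-i\,h_\alpha(i\lambda x)$, where $j_\alpha(z)=\Gamma(\alpha+1)\sum_{n\ge0}\frac{(-1)^n(z/2)^{2n}}{n!\,\Gamma(n+\alpha+1)}$ and $h_\alpha(z)=\Gamma(\alpha+1)\sum_{n\ge0}\frac{(-1)^n(z/2)^{2n+1}}{\Gamma(n+\frac32)\Gamma(n+\alpha+\frac32)}$. Equivalently, $S_\lambda^\alpha(x)=\frac{2\Gamma(\alpha+1)}{\sqrt\pi\,\Gamma(\alpha+\frac12)}\int_0^1(1-t^2)^{\alpha-\frac12}e^{\lambda xt}\,dt$. $L^1_\alpha(\mathbb{R})$ is the space of real-valued measurable functions $f$ on $\mathbb{R}$ with $\|f\|_{1,\alpha}=\int_{\mathbb{R}}|f(x)|\,d\mu_\alpha(x)<+\infty$, where $d\mu_\alpha(x)=|x|^{2\alpha+1}dx$. The Bessel-Struve transform of $f\in L^1_\alpha(\mathbb{R})$ is $\mathcal{F}_{B,S}^\alpha(f)(\lambda)=\int_{\mathbb{R}}f(x)\,S_{-i\lambda}^\alpha(x)\,d\mu_\alpha(x)$,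 $\lambda\in\mathbb{R}$. $C_0(\mathbb{R})$ is the space of continuous (complex-valued) functions on $\mathbb{R}$ tending to $0$ at infinity, and $\|\cdot\|_\infty$ is the sup norm. *)

theory Defs
  imports "HOL-Analysis.Analysis"
begin

definition bessel_j :: "real \<Rightarrow> complex \<Rightarrow> complex" where
  "bessel_j \<alpha> z = of_real (Gamma (\<alpha> + 1)) *
     (\<Sum>n. (-1) ^ n * (z / 2) ^ (2 * n) / of_real (fact n * Gamma (real n + \<alpha> + 1)))"

definition struve_h :: "real \<Rightarrow> complex \<Rightarrow> complex" where
  "struve_h \<alpha> z = of_real (Gamma (\<alpha> + 1)) *
     (\<Sum>n. (-1) ^ n * (z / 2) ^ (2 * n + 1) /
             of_real (Gamma (real n + 3 / 2) * Gamma (real n + \<alpha> + 3 / 2)))"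

definition bessel_struve_kernel :: "real \<Rightarrow> complex \<Rightarrow> real \<Rightarrow> complex" where
  "bessel_struve_kernel \<alpha> l x =
     bessel_j \<alpha> (\<i> * l * of_real x) - \<i> * struve_h \<alpha> (\<i> * l * of_real x)"

text \<open>Based on \<^term>\<open>lebesgue\<close> rather than \<^term>\<open>lborel\<close>, so that the functions in
  \<open>L1\<close> below may be Lebesgue measurable and not only Borel measurable.\<close>

definition mu :: "real \<Rightarrow> real measure" where
  "mu \<alpha> = density lebesgue (\<lambda>x. ennreal (\<bar>x\<bar> powr (2 * \<alpha> + 1)))"

definition L1 :: "real \<Rightarrow> (real \<Rightarrow> real) set" where
  "L1 \<alpha> = {f. integrable (mu \<alpha>) f}"

definition L1_norm :: "real \<Rightarrow> (real \<Rightarrow> real) \<Rightarrow> real" where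
  "L1_norm \<alpha> f = (LINT x|mu \<alpha>. \<bar>f x\<bar>)"

definition bessel_struve_transform :: "real \<Rightarrow> (real \<Rightarrow> real) \<Rightarrow> real \<Rightarrow> complex" where
  "bessel_struve_transform \<alpha> f l =
     (LINT x|mu \<alpha>. of_real (f x) * bessel_struve_kernel \<alpha> (- \<i> * of_real l) x)"

definition C0 :: "(real \<Rightarrow> complex) set" where
  "C0 = {g. continuous_on UNIV g \<and> (g \<longlongrightarrow> 0) at_infinity}"

text \<open>A real-valued supremum: meaningful for bounded functions only, in particular on \<open>C0\<close>.\<close>

definition sup_norm :: "(real \<Rightarrow> complex) \<Rightarrow> real" where
  "sup_norm g = (SUP l. norm (g l))"

end

(* At \<lambda> -> -i \<lambda> the kernel is k(\<lambda> x), where k is the Fourier transform of the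
   probability density w proportional to (1 - t^2)^(\<alpha> - 1/2) on (0,1): the even and odd moments
   of w are Beta values, and integrating the series of cos and sin against w gives the series of
   j and h. Hence |k| <= 1, k is continuous, and k vanishes at infinity by the Riemann-Lebesgue
   lemma. Dominated convergence with majorant |f| transfers these properties to the transform. *)

theory Submission
  imports Defs
begin


section \<open>The Riemann-Lebesgue lemma for almost everywhere continuous integrable
  functions\<close>

text \<open>Translates converge to \<open>g\<close> at each continuity point and all have the same
  L1 norm, so Scheffe's lemma upgrades almost everywhere convergence to L1 convergence. That lemma
  concerns sequences, hence the passage to sequences \<open>h\<close>.\<close>

lemma tendsto_translation_L1:
  fixes g :: "real \<Rightarrow> real"
  assumes int: "integrable lborel g" and cont: "AE t in lborel. isCont g t"
  shows "((\<lambda>h. LBINT t. \<bar>g (t + h) - g t\<bar>) \<longlongrightarrow> 0) (at 0)"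
  unfolding tendsto_at_iff_sequentially comp_def
proof (intro allI impI)
  fix h :: "nat \<Rightarrow> real"
  assume "\<forall>i. h i \<in> UNIV - {0}" and h: "h \<longlonglongrightarrow> 0"
  have shift: "integrable lborel (\<lambda>t. g (t + c))" for c
    using lborel_integrable_real_affine[OF int, of 1 c] by (simp add: add.commute)
  have norm_shift: "(\<integral>\<^sup>+t. norm (g (t + c)) \<partial>lborel) = (\<integral>\<^sup>+t. norm (g t) \<partial>lborel)" for c
    using nn_integral_real_affine[of "\<lambda>t. ennreal (norm (g t))" 1 c] int
    by (simp add: add.commute)
  have lim: "AE t in lborel. (\<lambda>n. g (t + h n)) \<longlonglongrightarrow> g t"
    using cont
  proof eventually_elim
    case (elim t)
    have "(\<lambda>n. t + h n) \<longlonglongrightarrow> t"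
      using tendsto_add[OF tendsto_const h, of t] by simp
    then show ?case
      using elim isCont_tendsto_compose by blast
  qed
  \<comment> \<open>The limsup condition of Scheffe's lemma holds with equality, since the norms are
    constant in \<open>n\<close>.\<close>
  have "(\<lambda>n. \<integral>\<^sup>+t. norm (g (t + h n) - g t) \<partial>lborel) \<longlonglongrightarrow> 0"
    by (rule Scheffe_lemma1) (simp_all add: shift int lim norm_shift Limsup_const del: real_norm_def)
  moreover have "(\<integral>\<^sup>+t. norm (g (t + c) - g t) \<partial>lborel) = ennreal (LBINT t. \<bar>g (t + c) - g t\<bar>)" for c
    using shift[of c] int by (subst nn_integral_eq_integral) auto
  ultimately have "(\<lambda>n. ennreal (LBINT t. \<bar>g (t + h n) - g t\<bar>)) \<longlonglongrightarrow> ennreal 0"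
    by simp
  then show "(\<lambda>n. LBINT t. \<bar>g (t + h n) - g t\<bar>) \<longlonglongrightarrow> 0"
    by (subst (asm) tendsto_ennreal_iff) auto
qed

text \<open>The integral is at most half the L1 distance between \<open>g\<close> and its translate
  by \<open>pi / u\<close>, and that translation tends to 0.\<close>

lemma Riemann_Lebesgue:
  fixes g :: "real \<Rightarrow> real"
  assumes int: "integrable lborel g" and cont: "AE t in lborel. isCont g t"
  shows "((\<lambda>u. LBINT t. of_real (g t) * cis (u * t)) \<longlongrightarrow> 0) at_infinity"
proof -
  have [measurable]: "g \<in> borel_measurable borel"
    using borel_measurable_integrable[OF int] by simp
  have intc: "integrable lborel (\<lambda>t. of_real (f t) * cis (u * t))"
    if "integrable lborel f" for f :: "real \<Rightarrow> real" and u
  proof (rule Bochner_Integration.integrable_bound[OF that])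
    have [measurable]: "f \<in> borel_measurable borel"
      using borel_measurable_integrable[OF that] by simp
    show "(\<lambda>t. of_real (f t) * cis (u * t)) \<in> borel_measurable lborel"
      by (simp add: cis_conv_exp)
  qed (simp add: norm_mult)
  have shift: "integrable lborel (\<lambda>t. g (t + c))" for c
    using lborel_integrable_real_affine[OF int, of 1 c] by (simp add: add.commute)
  have bound: "norm (LBINT t. of_real (g t) * cis (u * t))
      \<le> (LBINT t. \<bar>g (t + pi / u) - g t\<bar>) / 2" if "u \<noteq> 0" for u
  proof -
    let ?G = "LBINT t. of_real (g t) * cis (u * t)"
    \<comment> \<open>Translating by half a period changes the sign of the oscillating factor.\<close>
    have "?G = (LBINT t. - (of_real (g (t + pi / u)) * cis (u * t)))"
      using that
      by (subst lborel_integral_real_affine[of 1 _ "pi / u"])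
         (simp_all add: algebra_simps flip: cis_mult)
    then have "-2 * ?G = (LBINT t. of_real (g (t + pi / u)) * cis (u * t)) - ?G"
      by simp
    also have "\<dots> = (LBINT t. of_real (g (t + pi / u) - g t) * cis (u * t))"
      using intc[OF shift, of "pi / u" u] intc[OF int, of u]
      by (subst Bochner_Integration.integral_diff[symmetric]) (auto simp: left_diff_distrib)
    finally have "norm (-2 * ?G) = norm (LBINT t. of_real (g (t + pi / u) - g t) * cis (u * t))"
      by (rule arg_cong)
    then have "2 * norm ?G = norm (LBINT t. of_real (g (t + pi / u) - g t) * cis (u * t))"
      by (simp only: norm_mult norm_neg_numeral)
    also have "\<dots> \<le> (LBINT t. norm (of_real (g (t + pi / u) - g t) * cis (u * t)))"
      by (rule integral_norm_bound)
    also have "\<dots> = (LBINT t. \<bar>g (t + pi / u) - g t\<bar>)"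
      by (simp add: norm_mult del: of_real_diff)
    finally show ?thesis by simp
  qed
  \<comment> \<open>The filter \<open>at 0\<close> also demands that \<open>pi / u\<close> be
    eventually nonzero.\<close>
  have "filterlim (\<lambda>u::real. pi / u) (at 0) at_infinity"
    unfolding filterlim_at
    by (auto intro!: tendsto_divide_0[OF tendsto_const] filterlim_ident
             eventually_mono[OF eventually_not_equal_at_infinity])
  from filterlim_compose[OF tendsto_translation_L1[OF int cont] this]
  have "((\<lambda>u. (LBINT t. \<bar>g (t + pi / u) - g t\<bar>) / 2) \<longlongrightarrow> 0) at_infinity"
    by (rule tendsto_divide_zero)
  moreover have "\<forall>\<^sub>F u in at_infinity. norm (LBINT t. of_real (g t) * cis (u * t))
      \<le> (LBINT t. \<bar>g (t + pi / u) - g t\<bar>) / 2"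
    using eventually_not_equal_at_infinity[of 0] by eventually_elim (rule bound)
  ultimately show ?thesis
    by (rule Lim_null_comparison[rotated])
qed

section \<open>Integrals of a bounded continuous kernel under dilation\<close>

context
  fixes M :: "real measure" and g :: "real \<Rightarrow> real" and k :: "real \<Rightarrow> complex"
  assumes int: "integrable M g" and sets: "sets borel \<subseteq> sets M" and space: "space M = UNIV"
    and cont: "continuous_on UNIV k" and bound: "\<And>u. norm (k u) \<le> 1"
begin

text \<open>Continuity makes the kernel Borel measurable, and \<open>M\<close> may have more
  measurable sets than the Borel ones: this covers both \<open>lborel\<close> and \<open>mu\<close>,
  which carries the Lebesgue sets.\<close>

lemma dilation_kernel_measurable:
  "(\<lambda>x. of_real (g x) * k (u * x)) \<in> borel_measurable M"
proof -
  have "(\<lambda>x. k (u * x)) \<in> borel_measurable borel"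
    using cont by (intro borel_measurable_continuous_onI) (auto intro!: continuous_intros continuous_on_compose2[OF cont])
  then have "(\<lambda>x. k (u * x)) \<in> borel_measurable M"
    using sets space by (auto simp: measurable_def)
  with int show ?thesis
    by simp
qed

lemma norm_dilation_kernel_le: "norm (of_real (g x) * k u) \<le> \<bar>g x\<bar>"
  using mult_left_mono[OF bound[of u], of "\<bar>g x\<bar>"] by (simp add: norm_mult)

lemma integrable_dilation_kernel: "integrable M (\<lambda>x. of_real (g x) * k (u * x))"
  using norm_dilation_kernel_le
  by (intro Bochner_Integration.integrable_bound[OF int dilation_kernel_measurable]) simp

lemma norm_integral_dilation_kernel_le:
  "norm (LINT x|M. of_real (g x) * k (u * x)) \<le> (LINT x|M. \<bar>g x\<bar>)"
  by (rule Bochner_Integration.integral_norm_bound_integral[OF integrable_dilation_kernel])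
     (use int norm_dilation_kernel_le in auto)

text \<open>Dominated convergence along sequences with majorant \<open>\<bar>g x\<bar>\<close>. It
  serves twice: for the weight on \<open>lborel\<close>, giving continuity of the kernel, and for
  \<open>f\<close> on \<open>mu \<alpha>\<close>, giving continuity of the transform.\<close>

lemma continuous_on_integral_dilation_kernel:
  "continuous_on UNIV (\<lambda>u. LINT x|M. of_real (g x) * k (u * x))"
proof (rule continuous_at_imp_continuous_on, rule ballI, unfold isCont_def)
  fix u :: real
  show "((\<lambda>u. LINT x|M. of_real (g x) * k (u * x)) \<longlongrightarrow> (LINT x|M. of_real (g x) * k (u * x))) (at u)"
    unfolding tendsto_at_iff_sequentially comp_def
  proof (intro allI impI)
    fix X :: "nat \<Rightarrow> real" assume X: "X \<longlonglongrightarrow> u"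
    have "isCont k y" for y
      using cont by (simp add: continuous_on_eq_continuous_at)
    then have "(\<lambda>n. k (X n * x)) \<longlonglongrightarrow> k (u * x)" for x
      using X by (intro isCont_tendsto_compose[of _ k] tendsto_intros)
    then have "AE x in M. (\<lambda>n. of_real (g x) * k (X n * x)) \<longlonglongrightarrow> of_real (g x) * k (u * x)"
      by (intro AE_I2 tendsto_intros)
    moreover have "integrable M (\<lambda>x. \<bar>g x\<bar>)"
      using int by simp
    ultimately show "(\<lambda>n. LINT x|M. of_real (g x) * k (X n * x)) \<longlonglongrightarrow> (LINT x|M. of_real (g x) * k (u * x))"
      by (intro integral_dominated_convergence[where w = "\<lambda>x. \<bar>g x\<bar>"])
         (auto simp: dilation_kernel_measurable norm_dilation_kernel_le)
  qed
qed

text \<open>For \<open>x \<noteq> 0\<close> the argument \<open>u * x\<close> tends to infinity, so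
  the integrand tends to 0 under the majorant \<open>\<bar>g x\<bar>\<close>. At
  \<open>x = 0\<close> the integrand does not depend on \<open>u\<close>, hence the assumption
  \<open>nz\<close>.\<close>

lemma tendsto_at_top_integral_dilation_kernel:
  assumes nz: "AE x in M. x \<noteq> 0" and lim: "(k \<longlongrightarrow> 0) at_infinity"
  shows "((\<lambda>u. LINT x|M. of_real (g x) * k (u * x)) \<longlongrightarrow> 0) at_top"
proof -
  have "((\<lambda>u. LINT x|M. of_real (g x) * k (u * x)) \<longlongrightarrow> (LINT x|M. 0)) at_top"
  proof (rule integral_dominated_convergence_at_top[where w = "\<lambda>x. \<bar>g x\<bar>"])
    show "AE x in M. ((\<lambda>u. of_real (g x) * k (u * x)) \<longlongrightarrow> 0) at_top"
      using nz
    proof eventually_elim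
      case (elim x)
      have "filterlim (\<lambda>u. x * u) at_infinity at_top"
        by (intro tendsto_mult_filterlim_at_infinity[OF tendsto_const elim]
            filterlim_at_top_imp_at_infinity filterlim_ident)
      then show ?case
        by (intro tendsto_mult_right_zero filterlim_compose[OF lim]) (simp add: mult.commute)
    qed
  qed (use int in \<open>auto simp: dilation_kernel_measurable norm_dilation_kernel_le\<close>)
  then show ?thesis by simp
qed

end

text \<open>The limit at \<open>at_bot\<close> is the limit at \<open>at_top\<close> for the
  reflected kernel. The statement lies outside the context so that the previous lemma can be
  instantiated with both \<open>k\<close> and its reflection.\<close>

lemma tendsto_at_infinity_integral_dilation_kernel:
  fixes M :: "real measure" and g :: "real \<Rightarrow> real" and k :: "real \<Rightarrow> complex"
  assumes "integrable M g" "sets borel \<subseteq> sets M" "space M = UNIV"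
    and cont: "continuous_on UNIV k" and bound: "\<And>u. norm (k u) \<le> 1"
    and "AE x in M. x \<noteq> 0" and lim: "(k \<longlongrightarrow> 0) at_infinity"
  shows "((\<lambda>u. LINT x|M. of_real (g x) * k (u * x)) \<longlongrightarrow> 0) at_infinity"
  unfolding at_infinity_eq_at_top_bot
proof (rule filterlim_sup)
  show "((\<lambda>u. LINT x|M. of_real (g x) * k (u * x)) \<longlongrightarrow> 0) at_top"
    by (intro tendsto_at_top_integral_dilation_kernel assms)
  have "continuous_on UNIV (\<lambda>u. k (- u))"
    by (auto intro!: continuous_intros continuous_on_compose2[OF cont])
  moreover have "((\<lambda>u. k (- u)) \<longlongrightarrow> 0) at_infinity"
    by (intro filterlim_compose[OF lim]) (simp add: filterlim_at_infinity_conv_norm_at_top filterlim_norm_at_top flip: real_norm_def)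
  ultimately have "((\<lambda>u. LINT x|M. of_real (g x) * k (- (u * x))) \<longlongrightarrow> 0) at_top"
    using assms by (intro tendsto_at_top_integral_dilation_kernel) auto
  then show "((\<lambda>u. LINT x|M. of_real (g x) * k (u * x)) \<longlongrightarrow> 0) at_bot"
    by (simp add: filterlim_at_bot_mirror)
qed


section \<open>The weight of the integral representation and its moments\<close>

text \<open>Extended by zero to the whole line; the constant makes it a probability density when
  \<open>\<alpha> > - 1 / 2\<close>.\<close>

definition struve_weight :: "real \<Rightarrow> real \<Rightarrow> real" where
  "struve_weight \<alpha> t = 2 * Gamma (\<alpha> + 1) / (sqrt pi * Gamma (\<alpha> + 1 / 2)) *
     ((1 - t\<^sup>2) powr (\<alpha> - 1 / 2) * indicator {0<..<1} t)"

text \<open>The substitution \<open>s = t\<^sup>2\<close> in the Beta integral. Working with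
  nonnegative integrals yields integrability together with the value.\<close>

lemma has_bochner_integral_Beta_square:
  fixes b :: real
  assumes "b > 0"
  shows "has_bochner_integral lborel
     (\<lambda>t. t ^ k * ((1 - t\<^sup>2) powr (b - 1) * indicator {0<..<1} t)) (Beta ((real k + 1) / 2) b / 2)"
proof (rule has_bochner_integral_nn_integral)
  \<comment> \<open>Chosen so that \<open>2 * (a - 1) + 1 = k\<close>, the exponent left after
    multiplying by the derivative of the square.\<close>
  define a where "a = (real k + 1) / 2"
  define f where "f s = s powr (a - 1) * (1 - s) powr (b - 1)" for s :: real
  have "a > 0" by (simp add: a_def)
  have [measurable]: "f \<in> borel_measurable borel"
    unfolding f_def by measurable
  have "(f has_integral Beta a b) {0..1}"
    unfolding f_def using \<open>a > 0\<close> assms by (rule has_integral_Beta_real)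
  then have "((\<lambda>s. f s * indicator {0..1} s) has_integral Beta a b) UNIV"
    by (subst (asm) has_integral_restrict_UNIV[symmetric])
       (simp add: indicator_def of_bool_def if_distrib cong: if_cong)
  then have "ennreal (Beta a b) = (\<integral>\<^sup>+s. f s * indicator {0..1} s \<partial>lborel)"
    by (subst nn_integral_has_integral_lborel) (auto simp: f_def)
  \<comment> \<open>The endpoints are written as images under squaring to fit the substitution
    rule.\<close>
  also have "\<dots> = (\<integral>\<^sup>+s. f s * indicator {0\<^sup>2..1\<^sup>2} s \<partial>lborel)"
    by simp
  also have "\<dots> = (\<integral>\<^sup>+t. f (t\<^sup>2) * (2 * t) * indicator {0..1} t \<partial>lborel)"
    by (rule nn_integral_substitution) (auto intro!: derivative_eq_intros continuous_intros simp: set_borel_measurable_def)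
  also have "\<dots> = (\<integral>\<^sup>+t. ennreal 2 * ennreal (t ^ k * ((1 - t\<^sup>2) powr (b - 1) * indicator {0<..<1} t)) \<partial>lborel)"
  proof (rule nn_integral_cong_AE)
    \<comment> \<open>Off the two endpoints the closed and open interval indicators
      coincide.\<close>
    have "AE t in lborel. t \<noteq> (0::real) \<and> t \<noteq> 1"
      using AE_lborel_singleton[of "0::real"] AE_lborel_singleton[of "1::real"] by eventually_elim simp
    then show "AE t in lborel. ennreal (f (t\<^sup>2) * (2 * t) * indicator {0..1} t) =
        ennreal 2 * ennreal (t ^ k * ((1 - t\<^sup>2) powr (b - 1) * indicator {0<..<1} t))"
    proof eventually_elim
      case (elim t)
      show ?case
      proof (cases "t \<in> {0<..<1}")
        case True
        then have "(t\<^sup>2) powr (a - 1) * t = t powr (2 * (a - 1)) * t powr 1"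
          by (simp add: powr_powr flip: powr_numeral)
        also have "\<dots> = t powr (2 * (a - 1) + 1)"
          by (rule powr_add[symmetric])
        also have "2 * (a - 1) + 1 = real k"
          by (simp add: a_def field_simps)
        also have "t powr real k = t ^ k"
          using True by (simp add: powr_realpow)
        finally have "f (t\<^sup>2) * (2 * t) * indicator {0..1} t =
            2 * (t ^ k * ((1 - t\<^sup>2) powr (b - 1) * indicator {0<..<1} t))"
          using True by (simp add: f_def mult_ac)
        then show ?thesis
          by (simp only:) (rule ennreal_mult', simp)
      qed (use elim in \<open>auto simp: indicator_def\<close>)
    qed
  qed
  also have "\<dots> = ennreal 2 * (\<integral>\<^sup>+t. ennreal (t ^ k * ((1 - t\<^sup>2) powr (b - 1) * indicator {0<..<1} t)) \<partial>lborel)"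
    by (rule nn_integral_cmult) measurable
  \<comment> \<open>The factor 2 is cancelled in \<open>ennreal\<close> by multiplying with
    1/2.\<close>
  finally have "ennreal (1 / 2) * ennreal (Beta a b) =
      ennreal (1 / 2) * (ennreal 2 * (\<integral>\<^sup>+t. ennreal (t ^ k * ((1 - t\<^sup>2) powr (b - 1) * indicator {0<..<1} t)) \<partial>lborel))"
    by (rule arg_cong)
  moreover have "ennreal (1 / 2) * ennreal 2 = 1"
    by (subst ennreal_mult'[symmetric]) simp_all
  ultimately have "(\<integral>\<^sup>+t. ennreal (t ^ k * ((1 - t\<^sup>2) powr (b - 1) * indicator {0<..<1} t)) \<partial>lborel)
      = ennreal (1 / 2) * ennreal (Beta a b)"
    by (simp only: mult.assoc[symmetric] mult_1_left)
  also have "\<dots> = ennreal (1 / 2 * Beta a b)"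
    by (rule ennreal_mult'[symmetric]) simp
  finally show "(\<integral>\<^sup>+t. ennreal (t ^ k * ((1 - t\<^sup>2) powr (b - 1) * indicator {0<..<1} t)) \<partial>lborel)
      = ennreal (Beta ((real k + 1) / 2) b / 2)"
    by (simp add: a_def)
  show "0 \<le> Beta ((real k + 1) / 2) b / 2"
    using \<open>a > 0\<close> assms by (simp add: Beta_def less_imp_le flip: a_def)
qed (auto simp: indicator_def)

text \<open>The duplication formula at integers, by induction from the functional equation; clearing
  denominators lets the induction hypothesis rewrite a product.\<close>

lemma Gamma_nat_plus_half:
  "Gamma (real n + 1 / 2) * (4 ^ n * fact n) = sqrt pi * fact (2 * n)"
proof (induction n)
  case 0
  then show ?case by (simp add: Gamma_one_half_real)
next
  case (Suc n)
  have "Gamma (real (Suc n) + 1 / 2) * (4 ^ Suc n * fact (Suc n)) =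
      (real n + 1 / 2) * Gamma (real n + 1 / 2) * (4 ^ Suc n * fact (Suc n))"
    using Gamma_plus1[of "real n + 1 / 2"] by (simp add: nonpos_Ints_def add_ac)
  also have "\<dots> = (2 * real n + 1) * (2 * real n + 2) * (Gamma (real n + 1 / 2) * (4 ^ n * fact n))"
    by (simp add: algebra_simps)
  also have "\<dots> = sqrt pi * fact (2 * Suc n)"
    unfolding Suc.IH by (simp add: algebra_simps)
  finally show ?case .
qed

context
  fixes \<alpha> :: real
  assumes \<alpha>: "\<alpha> > - 1 / 2"
begin

lemma struve_weight_nonneg: "struve_weight \<alpha> t \<ge> 0"
  using \<alpha> by (auto simp: struve_weight_def intro!: mult_nonneg_nonneg divide_nonneg_nonneg)

text \<open>The Beta integral with \<open>b = \<alpha> + 1 / 2\<close>, positive by the hypothesis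
  on \<alpha>; \<open>Gamma (\<alpha> + 1 / 2)\<close> cancels against the normalising
  constant.\<close>

lemma struve_weight_moment:
  "has_bochner_integral lborel (\<lambda>t. struve_weight \<alpha> t * t ^ k)
     (Gamma (\<alpha> + 1) / sqrt pi * (Gamma ((real k + 1) / 2) / Gamma (real k / 2 + \<alpha> + 1)))"
proof -
  let ?c = "2 * Gamma (\<alpha> + 1) / (sqrt pi * Gamma (\<alpha> + 1 / 2))"
  have "Gamma (\<alpha> + 1 / 2) > 0"
    using \<alpha> by simp
  moreover have "Gamma ((real k + 1) / 2 + (\<alpha> + 1 / 2)) = Gamma (real k / 2 + \<alpha> + 1)"
    by (rule arg_cong[where f = Gamma]) (simp add: field_simps)
  ultimately have "?c * (Beta ((real k + 1) / 2) (\<alpha> + 1 / 2) / 2) =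
      Gamma (\<alpha> + 1) / sqrt pi * (Gamma ((real k + 1) / 2) / Gamma (real k / 2 + \<alpha> + 1))"
    by (simp add: Beta_def)
  moreover have "(\<lambda>t. struve_weight \<alpha> t * t ^ k) =
      (\<lambda>t. ?c * (t ^ k * ((1 - t\<^sup>2) powr (\<alpha> + 1 / 2 - 1) * indicator {0<..<1} t)))"
    by (simp add: struve_weight_def fun_eq_iff)
  ultimately show ?thesis
    using \<alpha> has_bochner_integral_mult_right[OF has_bochner_integral_Beta_square[of "\<alpha> + 1 / 2" k], of ?c]
    by (simp only:)
qed

lemma integrable_struve_weight: "integrable lborel (struve_weight \<alpha>)"
  using struve_weight_moment[of 0] by (simp add: has_bochner_integral_iff)

lemma integral_struve_weight: "(LBINT t. struve_weight \<alpha> t) = 1"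
proof -
  have "Gamma (\<alpha> + 1) > 0"
    using \<alpha> by simp
  then show ?thesis
    using struve_weight_moment[of 0] by (simp add: has_bochner_integral_iff Gamma_one_half_real)
qed

text \<open>The factor \<open>fact (2 * n)\<close> is kept apart to cancel the denominator of the
  cosine coefficient, leaving the coefficient of \<open>bessel_j\<close>.\<close>

lemma struve_weight_even_moment:
  "(LBINT t. struve_weight \<alpha> t * t ^ (2 * n)) =
     Gamma (\<alpha> + 1) * fact (2 * n) / (4 ^ n * fact n * Gamma (real n + \<alpha> + 1))"
proof -
  have "Gamma (real n + 1 / 2) = sqrt pi * fact (2 * n) / (4 ^ n * fact n)"
    using Gamma_nat_plus_half[of n] by (simp add: field_simps)
  then show ?thesis
    using struve_weight_moment[of "2 * n"]
    by (simp add: has_bochner_integral_iff add_divide_distrib add_ac)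
qed

text \<open>The general moment contains \<open>fact n\<close> here; it is traded for
  \<open>fact (2 * n + 1)\<close> over \<open>Gamma (real n + 3 / 2)\<close> to match the sine
  series and \<open>struve_h\<close>.\<close>

lemma struve_weight_odd_moment:
  "(LBINT t. struve_weight \<alpha> t * t ^ (2 * n + 1)) =
     Gamma (\<alpha> + 1) * fact (2 * n + 1) / (2 ^ (2 * n + 1) * Gamma (real n + 3 / 2) * Gamma (real n + \<alpha> + 3 / 2))"
proof -
  have "Gamma (real n + 3 / 2) = sqrt pi * fact (2 * n + 1) / (2 ^ (2 * n + 1) * fact n)"
  proof -
    have "Gamma (real n + 3 / 2) = (real n + 1 / 2) * Gamma (real n + 1 / 2)"
      using Gamma_plus1[of "real n + 1 / 2"] by (simp add: nonpos_Ints_def add.commute)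
    also have "Gamma (real n + 1 / 2) = sqrt pi * fact (2 * n) / (4 ^ n * fact n)"
      using Gamma_nat_plus_half[of n] by (simp add: field_simps)
    finally show ?thesis
      by (simp add: power_mult divide_simps) (simp add: algebra_simps)
  qed
  moreover have "Gamma (real n + 1) = fact n"
    by (metis Gamma_fact add.commute)
  moreover have "real (2 * n + 1) / 2 + \<alpha> + 1 = real n + \<alpha> + 3 / 2" "(real (2 * n + 1) + 1) / 2 = real n + 1"
    by (simp_all add: field_simps)
  moreover have "(LBINT t. struve_weight \<alpha> t * t ^ (2 * n + 1)) = Gamma (\<alpha> + 1) / sqrt pi *
      (Gamma ((real (2 * n + 1) + 1) / 2) / Gamma (real (2 * n + 1) / 2 + \<alpha> + 1))"
    by (rule has_bochner_integral_integral_eq[OF struve_weight_moment])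
  ultimately show ?thesis
    by (simp only:) simp
qed

section \<open>The kernel as a Fourier integral of the weight\<close>

text \<open>Termwise integration: on the support \<open>\<bar>t\<bar> < 1\<close>, and the weight
  has mass 1, so the terms are dominated by those of an exponential series. The exponents
  \<open>e\<close> cover the cosine and sine series at once.\<close>

lemma struve_weight_power_series:
  fixes c :: "nat \<Rightarrow> real"
  assumes bound: "\<And>n. \<bar>c n\<bar> \<le> 1 / fact (e n)" and e: "inj e"
    and F: "\<And>x. (\<lambda>n. c n * x ^ e n) sums F x"
  shows "(\<lambda>n. c n * u ^ e n * (LBINT t. struve_weight \<alpha> t * t ^ e n)) sums
           (LBINT t. struve_weight \<alpha> t * F (u * t))"
proof -
  define a where "a n t = c n * u ^ e n * (struve_weight \<alpha> t * t ^ e n)" for n t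
  have a_int: "integrable lborel (a n)" for n
    using struve_weight_moment[of "e n"] unfolding a_def
    by (intro Bochner_Integration.integrable_mult_right) (simp add: has_bochner_integral_iff)
  have supp: "struve_weight \<alpha> t = 0" if "t \<notin> {0<..<1}" for t
    using that by (simp add: struve_weight_def)
  have a_bound: "norm (a n t) \<le> \<bar>u\<bar> ^ e n / fact (e n) * struve_weight \<alpha> t" for n t
  proof (cases "t \<in> {0<..<1}")
    case True
    then have "\<bar>t\<bar> ^ e n \<le> 1"
      by (intro power_le_one) auto
    moreover have "norm (a n t) = \<bar>c n\<bar> * \<bar>u\<bar> ^ e n * (struve_weight \<alpha> t * \<bar>t\<bar> ^ e n)"
      by (simp add: a_def abs_mult power_abs struve_weight_nonneg)
    ultimately have "norm (a n t) \<le> 1 / fact (e n) * \<bar>u\<bar> ^ e n * (struve_weight \<alpha> t * 1)"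
      using struve_weight_nonneg[of t] bound[of n]
      by (simp only:) (intro mult_mono order_refl mult_nonneg_nonneg zero_le_power abs_ge_zero, auto)
    then show ?thesis by simp
  qed (simp add: a_def supp)
  \<comment> \<open>Injectivity of \<open>e\<close> makes this a rearranged subseries of the
    exponential series at \<open>\<bar>u\<bar>\<close>.\<close>
  have summ: "summable (\<lambda>n. \<bar>u\<bar> ^ e n / fact (e n))"
    using summable_reindex[of "\<lambda>m. \<bar>u\<bar> ^ m / fact m" e] summable_exp_generic[of "\<bar>u\<bar>"] e
    by (simp add: comp_def divide_inverse mult.commute)
  have "(\<lambda>n. integral\<^sup>L lborel (a n)) sums (LBINT t. (\<Sum>n. a n t))"
  proof (rule sums_integral[OF a_int])
    show "AE t in lborel. summable (\<lambda>n. norm (a n t))"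
    proof (rule AE_I2)
      fix t
      show "summable (\<lambda>n. norm (a n t))"
        using a_bound[of _ t] by (intro summable_comparison_test'[OF summable_mult2[OF summ], of 0]) simp
    qed
    have "(LBINT t. norm (a n t)) \<le> \<bar>u\<bar> ^ e n / fact (e n)" for n
    proof -
      have "(LBINT t. norm (a n t)) \<le> (LBINT t. \<bar>u\<bar> ^ e n / fact (e n) * struve_weight \<alpha> t)"
        using a_int a_bound integrable_struve_weight by (intro integral_mono) auto
      then show ?thesis
        by (simp add: integral_struve_weight)
    qed
    then show "summable (\<lambda>n. LBINT t. norm (a n t))"
      by (intro summable_comparison_test'[OF summ, where N = 0]) simp
  qed
  moreover have "(\<Sum>n. a n t) = struve_weight \<alpha> t * F (u * t)" for t
    using sums_mult[OF F[of "u * t"], of "struve_weight \<alpha> t"]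
    by (intro sums_unique[symmetric]) (simp add: a_def power_mult_distrib mult_ac)
  moreover have "integral\<^sup>L lborel (a n) = c n * u ^ e n * (LBINT t. struve_weight \<alpha> t * t ^ e n)" for n
    unfolding a_def[abs_def] by (rule integral_mult_right_zero)
  ultimately show ?thesis
    by (simp only:)
qed

text \<open>The cosine series is integrated termwise and the even moments inserted;
  \<open>Gamma (\<alpha> + 1)\<close> is divided out because \<open>bessel_j\<close> has it in front
  of the sum.\<close>

lemma bessel_j_eq_integral:
  "bessel_j \<alpha> (of_real u) = of_real (LBINT t. struve_weight \<alpha> t * cos (u * t))"
proof -
  have Gamma_nz: "Gamma (\<alpha> + 1) \<noteq> 0"
    using \<alpha> Gamma_real_pos[of "\<alpha> + 1"] by linarith
  have "(\<lambda>n. (- 1) ^ n / fact (2 * n) * u ^ (2 * n) * (LBINT t. struve_weight \<alpha> t * t ^ (2 * n)))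
      sums (LBINT t. struve_weight \<alpha> t * cos (u * t))"
    by (rule struve_weight_power_series[OF _ _ cos_paired]) (auto simp: abs_mult inj_def)
  also have "(\<lambda>n. (- 1) ^ n / fact (2 * n) * u ^ (2 * n) * (LBINT t. struve_weight \<alpha> t * t ^ (2 * n))) =
     (\<lambda>n. Gamma (\<alpha> + 1) * ((- 1) ^ n * (u / 2) ^ (2 * n) / (fact n * Gamma (real n + \<alpha> + 1))))"
    unfolding struve_weight_even_moment by (simp add: fun_eq_iff power_divide power_mult) (simp add: mult_ac)
  finally have "(\<lambda>n. (- 1) ^ n * (u / 2) ^ (2 * n) / (fact n * Gamma (real n + \<alpha> + 1)))
      sums ((LBINT t. struve_weight \<alpha> t * cos (u * t)) / Gamma (\<alpha> + 1))"
    using Gamma_nz by (subst sums_mult_iff[of "Gamma (\<alpha> + 1)", symmetric]) simp_all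
  from sums_of_real[OF this, where 'a = complex]
  show ?thesis
    using Gamma_nz unfolding bessel_j_def by (simp add: sums_iff)
qed

text \<open>The same argument with the sine series and the odd moments.\<close>

lemma struve_h_eq_integral:
  "struve_h \<alpha> (of_real u) = of_real (LBINT t. struve_weight \<alpha> t * sin (u * t))"
proof -
  have Gamma_nz: "Gamma (\<alpha> + 1) \<noteq> 0"
    using \<alpha> Gamma_real_pos[of "\<alpha> + 1"] by linarith
  have "(\<lambda>n. (- 1) ^ n / fact (2 * n + 1) * u ^ (2 * n + 1) * (LBINT t. struve_weight \<alpha> t * t ^ (2 * n + 1)))
      sums (LBINT t. struve_weight \<alpha> t * sin (u * t))"
    by (rule struve_weight_power_series[OF _ _ sin_paired]) (auto simp: abs_mult inj_def)
  also have "(\<lambda>n. (- 1) ^ n / fact (2 * n + 1) * u ^ (2 * n + 1) * (LBINT t. struve_weight \<alpha> t * t ^ (2 * n + 1))) =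
     (\<lambda>n. Gamma (\<alpha> + 1) * ((- 1) ^ n * (u / 2) ^ (2 * n + 1) / (Gamma (real n + 3 / 2) * Gamma (real n + \<alpha> + 3 / 2))))"
    unfolding struve_weight_odd_moment by (simp add: fun_eq_iff power_divide mult_ac)
  finally have "(\<lambda>n. (- 1) ^ n * (u / 2) ^ (2 * n + 1) / (Gamma (real n + 3 / 2) * Gamma (real n + \<alpha> + 3 / 2)))
      sums ((LBINT t. struve_weight \<alpha> t * sin (u * t)) / Gamma (\<alpha> + 1))"
    using Gamma_nz by (subst sums_mult_iff[of "Gamma (\<alpha> + 1)", symmetric]) simp_all
  from sums_of_real[OF this, where 'a = complex]
  show ?thesis
    using Gamma_nz unfolding struve_h_def by (simp add: sums_iff)
qed

text \<open>The two factors \<i> and -\<i> cancel, so both functions are evaluated at the real point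
  \<open>l * x\<close>, and cosine minus \<i> times sine is \<open>cis\<close> of the negated
  angle.\<close>

lemma bessel_struve_kernel_eq_integral:
  "bessel_struve_kernel \<alpha> (- \<i> * of_real l) x =
     (LBINT t. of_real (struve_weight \<alpha> t) * cis (- (l * x * t)))"
proof -
  have meas: "struve_weight \<alpha> \<in> borel_measurable lborel"
    using integrable_struve_weight by (rule borel_measurable_integrable)
  have trig: "integrable lborel (\<lambda>t. struve_weight \<alpha> t * cos (u * t))"
       "integrable lborel (\<lambda>t. struve_weight \<alpha> t * sin (u * t))" for u
    using meas mult_left_mono[OF abs_cos_le_one struve_weight_nonneg]
      mult_left_mono[OF abs_sin_le_one struve_weight_nonneg]
    by (auto intro!: Bochner_Integration.integrable_bound[OF integrable_struve_weight]
        simp: abs_mult struve_weight_nonneg)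
  have "\<i> * (- \<i> * of_real l) * of_real x = of_real (l * x)"
    by (simp flip: mult.assoc)
  then have "bessel_struve_kernel \<alpha> (- \<i> * of_real l) x =
     of_real (LBINT t. struve_weight \<alpha> t * cos (l * x * t)) - \<i> * of_real (LBINT t. struve_weight \<alpha> t * sin (l * x * t))"
    unfolding bessel_struve_kernel_def by (simp only: bessel_j_eq_integral struve_h_eq_integral)
  also have "\<dots> = (LBINT t. of_real (struve_weight \<alpha> t * cos (l * x * t)) - \<i> * of_real (struve_weight \<alpha> t * sin (l * x * t)))"
    unfolding integral_complex_of_real[symmetric] integral_mult_right_zero[symmetric]
    by (intro Bochner_Integration.integral_diff[symmetric] integrable_mult_right integrable_of_real trig)
  also have "(\<lambda>t. of_real (struve_weight \<alpha> t * cos (l * x * t)) - \<i> * of_real (struve_weight \<alpha> t * sin (l * x * t))) =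
      (\<lambda>t. of_real (struve_weight \<alpha> t) * cis (- (l * x * t)))"
    by (simp add: fun_eq_iff complex_eq_iff)
  finally show ?thesis .
qed

text \<open>Supplies the continuity hypothesis of \<open>Riemann_Lebesgue\<close>: the weight can be
  discontinuous only at 0 and 1.\<close>

lemma AE_isCont_struve_weight: "AE t in lborel. isCont (struve_weight \<alpha>) t"
proof -
  have "AE t in lborel. t \<noteq> (0::real) \<and> t \<noteq> 1"
    using AE_lborel_singleton[of "0::real"] AE_lborel_singleton[of "1::real"] by eventually_elim simp
  then show ?thesis
  proof eventually_elim
    case (elim t)
    show ?case
    proof (cases "t \<in> {0<..<1}")
      case True
      then have "t\<^sup>2 < 1"
        by (simp add: power_less_one_iff)
      then have "isCont (\<lambda>t. 2 * Gamma (\<alpha> + 1) / (sqrt pi * Gamma (\<alpha> + 1 / 2)) * (1 - t\<^sup>2) powr (\<alpha> - 1 / 2)) t"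
        by (intro continuous_intros) auto
      moreover have eq: "\<forall>\<^sub>F s in nhds t. struve_weight \<alpha> s =
          2 * Gamma (\<alpha> + 1) / (sqrt pi * Gamma (\<alpha> + 1 / 2)) * (1 - s\<^sup>2) powr (\<alpha> - 1 / 2)"
        using eventually_nhds_in_open[OF open_greaterThanLessThan True]
        by eventually_elim (simp add: struve_weight_def)
      ultimately show ?thesis
        unfolding isCont_cong[OF eq] by blast
    next
      case False
      then have "t \<in> - {0..1}"
        using elim by auto
      then have "\<forall>\<^sub>F s in nhds t. s \<in> - {0..1}"
        by (intro eventually_nhds_in_open) auto
      then have eq: "\<forall>\<^sub>F s in nhds t. struve_weight \<alpha> s = 0"
        by eventually_elim (auto simp: struve_weight_def)
      show ?thesis
        unfolding isCont_cong[OF eq] by simp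
    qed
  qed
qed

end

section \<open>Application to the Bessel-Struve transform\<close>

text \<open>A point is Lebesgue null, and a measure given by a density inherits null sets.\<close>

lemma AE_mu_nonzero: "AE x in mu \<alpha>. x \<noteq> 0"
proof -
  have "(\<lambda>x::real. ennreal (\<bar>x\<bar> powr (2 * \<alpha> + 1))) \<in> borel_measurable lebesgue"
    by (rule measurable_completion) simp
  then show ?thesis
    unfolding mu_def
    using AE_completion[OF AE_lborel_singleton[of "0::real"]] by (subst AE_density) auto
qed

theorem theorem2p1:
  fixes \<alpha> :: real and f :: "real \<Rightarrow> real"
  assumes "\<alpha> > - 1 / 2"
    and "f \<in> L1 \<alpha>"
  shows "bessel_struve_transform \<alpha> f \<in> C0 \<and>
         sup_norm (bessel_struve_transform \<alpha> f) \<le> L1_norm \<alpha> f"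
proof -
  define k where "k u = (LBINT t. of_real (struve_weight \<alpha> t) * cis (- (u * t)))" for u
  have kernel: "bessel_struve_kernel \<alpha> (- \<i> * of_real l) x = k (l * x)" for l x
    unfolding k_def by (rule bessel_struve_kernel_eq_integral[OF assms(1)])
  have transform: "bessel_struve_transform \<alpha> f = (\<lambda>l. LINT x|mu \<alpha>. of_real (f x) * k (l * x))"
    by (rule ext) (simp only: bessel_struve_transform_def kernel)
  have weight: "integrable lborel (struve_weight \<alpha>)"
    using assms(1) by (rule integrable_struve_weight)
  have cis_cont: "continuous_on UNIV (\<lambda>u. cis (- u))"
    by (intro continuous_intros)
  \<comment> \<open>First use of the dilation lemmas: the weight on \<open>lborel\<close> against
    \<open>cis (- u)\<close>.\<close>
  have k_cont: "continuous_on UNIV k"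
    unfolding k_def by (rule continuous_on_integral_dilation_kernel[OF weight _ _ cis_cont]) auto
  have k_bound: "norm (k u) \<le> 1" for u
    using norm_integral_dilation_kernel_le[OF weight _ _ cis_cont, of u]
    by (simp add: k_def integral_struve_weight[OF assms(1)] struve_weight_nonneg[OF assms(1)])
  \<comment> \<open>Reflection accounts for the opposite signs of the phase in \<open>k\<close> and
    in \<open>Riemann_Lebesgue\<close>.\<close>
  have "filterlim uminus at_infinity (at_infinity :: real filter)"
    by (simp add: filterlim_at_infinity_conv_norm_at_top filterlim_norm_at_top flip: real_norm_def)
  from filterlim_compose[OF Riemann_Lebesgue[OF weight AE_isCont_struve_weight[OF assms(1)]] this]
  have k_lim: "(k \<longlongrightarrow> 0) at_infinity"
    by (simp add: k_def[abs_def])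
  have f: "integrable (mu \<alpha>) f"
    using assms(2) by (simp add: L1_def)
  have mu: "sets borel \<subseteq> sets (mu \<alpha>)" "space (mu \<alpha>) = UNIV"
    by (auto simp: mu_def)
  \<comment> \<open>Second use of the dilation lemmas: \<open>f\<close> on
    \<open>mu \<alpha>\<close> against \<open>k\<close>.\<close>
  have "bessel_struve_transform \<alpha> f \<in> C0"
    unfolding C0_def transform
    using continuous_on_integral_dilation_kernel[OF f mu k_cont k_bound]
      tendsto_at_infinity_integral_dilation_kernel[OF f mu k_cont k_bound AE_mu_nonzero k_lim]
    by simp
  moreover have "sup_norm (bessel_struve_transform \<alpha> f) \<le> L1_norm \<alpha> f"
    unfolding sup_norm_def L1_norm_def transform
    by (intro cSUP_least norm_integral_dilation_kernel_le[OF f mu k_cont k_bound]) auto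
  ultimately show ?thesis by simp
qed

end
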